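(* Let $d,B\ge 1$ be integers and let $\mathcal{G}=\{G_r\}_{r=1}^{B}$ with $G_r\subset\{1,\dots,d\}$ and $\bigcup_{r=1}^{B}G_r=\{1,\dots,d\}$. Let $p\ge 1$ (the value $p=+\infty$ being allowed), let $q$ be the conjugate exponent of $p$, and let $\Omega^{\mathcal{G}}_p:\mathbb{R}^d\to[0,+\infty)$ be the penalty $$\Omega^{\mathcal{G}}_p(x)=\min_{\substack{v\in\prod_{r=1}^{B}\mathbb{R}^{G_r}\\ P^*v=x}}\ \sum_{r=1}^{B}\|v_r\|_p .$$ Then for every $\lambda>0$ the proximity operator of $\lambda\Omega^{\mathcal{G}}_p$ is $$\mathrm{prox}_{\lambda\Omega^{\mathcal{G}}_p}=I-\pi_{\lambda K_p^{\mathcal{G}}},$$ where $I$ is the identity of $\mathbb{R}^d$, $\pi_{\lambda K_p^{\mathcal{G}}}$ denotes the (Euclidean) projection onto $\lambda K_p^{\mathcal{G}}$, and $$K_p^{\mathcal{G}}=\{x\in\mathbb{R}^d:\ \|x\|_{G_r,q}\le 1\ \text{ for } r=1,\dots,B\}.$$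
   Context: Conjugate exponents: $1/p+1/q=1$ (so $q=\infty$ if $p=1$ and $q=1$ if $p=+\infty$). $\|\cdot\|_p$ is the $\ell_p$ norm and $\|\cdot\|=\|\cdot\|_2$. For $G\subset\{1,\dots,d\}$ and $x\in\mathbb{R}^d$, $\|x\|_{G,q}$ is the $\ell_q$ norm of the restriction of $x$ to the coordinates in $G$: $\|x\|_{G,q}=(\sum_{j\in G}|x_j|^q)^{1/q}$ for $q<\infty$, and $\|x\|_{G,\infty}=\max_{j\in G}|x_j|$. For each $r$, $P_r:\mathbb{R}^d\to\mathbb{R}^{G_r}$ is the canonical projection (restriction to the coordinates in $G_r$) and its adjoint $P_r^*:\mathbb{R}^{G_r}\to\mathbb{R}^d$ is the canonical injection (extension by zero). The operator $P^*:\prod_{r=1}^{B}\mathbb{R}^{G_r}\to\mathbb{R}^d$ is $P^*(v_1,\dots,v_B)=\sum_{r=1}^{B}P_r^*v_r$. The proximity operator is defined, for $\lambda>0$ and $z\in\mathbb{R}^d$, by $$\mathrm{prox}_{\lambda\Omega^{\mathcal{G}}_p}(z)=\mathop{\mathrm{argmin}}_{x\in\mathbb{R}^d}\ \left\{\frac{1}{2\lambda}\|x-z\|^2+\Omega^{\mathcal{G}}_p(x)\right\}.$$ *)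

theory Defs
  imports "HOL-Analysis.Analysis"
begin

text \<open>
  The \<open>\<ell>\<^sub>p\<close> norm of the coordinates in a finite set \<open>G\<close>; only exponents \<open>p \<ge> 1\<close> are meant,
  with \<open>p = \<infinity>\<close> included. The inserted \<open>0\<close> changes nothing unless \<open>G\<close> is empty, where it makes
  the maximum \<open>0\<close>, in accordance with the value of the empty sum for finite \<open>p\<close>.
\<close>

definition lp_norm_on :: "ennreal \<Rightarrow> 'i set \<Rightarrow> ('i \<Rightarrow> real) \<Rightarrow> real" where
  "lp_norm_on p G f =
     (if p = \<infinity> then Max (insert 0 ((\<lambda>j. \<bar>f j\<bar>) ` G))
      else (\<Sum>j\<in>G. \<bar>f j\<bar> powr enn2real p) powr (1 / enn2real p))"

text \<open>
  The coordinates are indexed by the finite type \<open>'n\<close>, so \<open>d = CARD('n)\<close>. An element of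
  \<open>\<real>\<^bsup>G\<^esup>\<close> is a function in \<open>G \<rightarrow>\<^sub>E UNIV\<close>.
\<close>

definition group_inj :: "'n set \<Rightarrow> ('n \<Rightarrow> real) \<Rightarrow> real ^ 'n" where
  "group_inj G u = (\<chi> j. if j \<in> G then u j else 0)"

definition group_sum :: "(nat \<Rightarrow> 'n set) \<Rightarrow> nat \<Rightarrow> (nat \<Rightarrow> 'n \<Rightarrow> real) \<Rightarrow> real ^ 'n" where
  "group_sum G B v = (\<Sum>r = 1..B. group_inj (G r) (v r))"

definition decompositions ::
    "(nat \<Rightarrow> 'n set) \<Rightarrow> nat \<Rightarrow> real ^ 'n \<Rightarrow> (nat \<Rightarrow> 'n \<Rightarrow> real) set" where
  "decompositions G B x =
     {v \<in> (\<Pi>\<^sub>E r\<in>{1..B}. G r \<rightarrow>\<^sub>E UNIV). group_sum G B v = x}"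

definition group_cost ::
    "ennreal \<Rightarrow> (nat \<Rightarrow> 'n set) \<Rightarrow> nat \<Rightarrow> (nat \<Rightarrow> 'n \<Rightarrow> real) \<Rightarrow> real" where
  "group_cost p G B v = (\<Sum>r = 1..B. lp_norm_on p (G r) (v r))"

text \<open>
  \<open>LEAST\<close> on the reals denotes the minimum, and is unspecified when no minimum is attained.
\<close>

definition group_penalty :: "ennreal \<Rightarrow> (nat \<Rightarrow> 'n set) \<Rightarrow> nat \<Rightarrow> real ^ 'n \<Rightarrow> real" where
  "group_penalty p G B x = (LEAST t. t \<in> group_cost p G B ` decompositions G B x)"

definition prox_objective ::
    "real \<Rightarrow> ('a::real_normed_vector \<Rightarrow> real) \<Rightarrow> 'a \<Rightarrow> 'a \<Rightarrow> real" where
  "prox_objective l f z x = 1 / (2 * l) * (norm (x - z))\<^sup>2 + f x"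

text \<open>The proximity operator of \<open>l f\<close>; meaningful when the minimizer exists and is unique.\<close>

definition prox :: "real \<Rightarrow> ('a::real_normed_vector \<Rightarrow> real) \<Rightarrow> 'a \<Rightarrow> 'a" where
  "prox l f z = (THE x. is_arg_min (prox_objective l f z) (\<lambda>_. True) x)"

definition dual_unit_set :: "ennreal \<Rightarrow> (nat \<Rightarrow> 'n set) \<Rightarrow> nat \<Rightarrow> (real ^ 'n) set" where
  "dual_unit_set q G B = {x. \<forall>r\<in>{1..B}. lp_norm_on q (G r) (\<lambda>j. x $ j) \<le> 1}"

end

theory Submission imports Defs begin

text \<open>
  The penalty \<open>\<Omega>\<close> is the support function of the set \<open>K\<close>, that is,
  \<open>\<Omega> x = max {k \<bullet> x | k. k \<in> K}\<close>. Once this is known, the formula for the proximity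
  operator is Moreau's decomposition: the projection of \<open>z\<close> onto \<open>l K\<close> is characterised by the
  variational inequality, which says exactly that the projection, divided by \<open>l\<close>, is the element of
  \<open>K\<close> where the support function at the residual is attained.

  That \<open>k \<bullet> x \<le> \<Omega> x\<close> on \<open>K\<close> is Hoelder's inequality applied to each summand of a
  decomposition (\<open>inner_le_group_cost\<close>). The converse, together with the attainment of the minimum
  that defines \<open>\<Omega>\<close>, is a separation argument (\<open>decomposition_attaining_support\<close>). The
  supported balls of the groups are compact and convex, so the convex hull \<open>U\<close> of
  their union is compact, and \<open>K\<close> is the polar of \<open>U\<close> because Hoelder's inequality is sharp. If
  \<open>s\<close> is the maximum of \<open>k \<bullet> x\<close> over \<open>K\<close>, then \<open>x\<close> lies in \<open>s U\<close>: a hyperplane that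
  separates \<open>x\<close> from \<open>s U\<close> would, after rescaling, give an element of \<open>K\<close> whose inner product with
  \<open>x\<close> exceeds \<open>s\<close>. Writing a point of \<open>s U\<close> as a combination of points of the balls gives a
  decomposition of \<open>x\<close> whose cost is at most \<open>s\<close>.

  The sharp form of Hoelder's inequality also writes each \<open>\<ell>\<^sub>p\<close> unit ball as an intersection of
  half-spaces (\<open>lp_unit_ball_polar\<close>), which gives convexity and closedness at once for all
  exponents.
\<close>

section \<open>Conjugate exponents and \<open>\<ell>\<^sub>p\<close> norms on a set of coordinates\<close>

lemma conjugate_exponents_cases:
  fixes p q :: ennreal
  assumes "p \<ge> 1" and "1 / p + 1 / q = 1"
  obtains "p = 1" "q = \<infinity>"
    | "p = \<infinity>" "q = 1"
    | a b :: real where "a > 1" "b > 1" "1 / a + 1 / b = 1" "p = ennreal a" "q = ennreal b"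
proof (cases p rule: ennreal_cases)
  case top
  have "q = 1"
  proof (cases q rule: ennreal_cases)
    case (real b)
    have "b \<noteq> 0"
      using assms(2) top real by auto
    then have "ennreal (1 / b) = 1"
      using assms(2) top real by (simp add: divide_ennreal flip: ennreal_1)
    then have "b = 1"
      using real by (simp add: ennreal_eq_1)
    then show ?thesis using real by simp
  qed (use assms(2) top in auto)
  then show ?thesis using top that(2) by auto
next
  case (real a)
  have a: "a \<ge> 1"
    using assms(1) real by (simp flip: ennreal_1)
  have pa: "1 / p = ennreal (1 / a)"
    using a real by (simp add: divide_ennreal flip: ennreal_1)
  show ?thesis
  proof (cases q rule: ennreal_cases)
    case top
    then have "ennreal (1 / a) = 1"
      using assms(2) pa by simp
    then have "a = 1"
      using a by (simp add: ennreal_eq_1)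
    then show ?thesis using that(1) top real by auto
  next
    case q: (real b)
    have "b \<noteq> 0"
      using assms(2) q by auto
    then have b: "b > 0" using q by simp
    have "1 / q = ennreal (1 / b)"
      using b q by (simp add: divide_ennreal flip: ennreal_1)
    then have "ennreal (1 / a + 1 / b) = 1"
      using assms(2) pa a b by simp
    then have ab: "1 / a + 1 / b = 1"
      using a b by (simp add: ennreal_eq_1 del: ennreal_plus)
    have "1 / a > 0" "1 / b > 0" using a b by auto
    then have "1 / a < 1" "1 / b < 1" using ab by linarith+
    then have "a > 1" "b > 1" using a b by auto
    then show ?thesis using that(3) ab real q by auto
  qed
qed

lemma conjugate_exponents_sym:
  fixes p q :: ennreal
  assumes "p \<ge> 1" and "1 / p + 1 / q = 1"
  shows "q \<ge> 1" and "1 / q + 1 / p = 1"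
  using conjugate_exponents_cases[OF assms, of "q \<ge> 1"] assms(2)
  by (auto simp: add.commute simp flip: ennreal_1)

lemma lp_norm_on_top:
  "lp_norm_on top G f = Max (insert 0 ((\<lambda>j. \<bar>f j\<bar>) ` G))"
  by (simp add: lp_norm_on_def)

lemma lp_norm_on_real:
  "a \<ge> 0 \<Longrightarrow> lp_norm_on (ennreal a) G f = (\<Sum>j\<in>G. \<bar>f j\<bar> powr a) powr (1 / a)"
  by (simp add: lp_norm_on_def)

lemma lp_norm_on_1: "lp_norm_on 1 G f = (\<Sum>j\<in>G. \<bar>f j\<bar>)"
  by (simp add: lp_norm_on_def sum_nonneg)

lemma lp_norm_on_cong:
  assumes "\<And>j. j \<in> G \<Longrightarrow> f j = g j"
  shows "lp_norm_on p G f = lp_norm_on p G g"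
proof -
  have "(\<lambda>j. \<bar>f j\<bar>) ` G = (\<lambda>j. \<bar>g j\<bar>) ` G"
    by (rule image_cong) (simp_all add: assms)
  moreover have "(\<Sum>j\<in>G. \<bar>f j\<bar> powr enn2real p) = (\<Sum>j\<in>G. \<bar>g j\<bar> powr enn2real p)"
    by (rule sum.cong) (simp_all add: assms)
  ultimately show ?thesis by (simp add: lp_norm_on_def)
qed

lemma lp_norm_on_nonneg:
  assumes "finite G"
  shows "lp_norm_on p G f \<ge> 0"
  using assms by (auto simp: lp_norm_on_def)

lemma exponent_cases:
  fixes p :: ennreal
  assumes "p \<ge> 1"
  obtains "p = \<infinity>" | a :: real where "a \<ge> 1" "p = ennreal a"
  using assms by (cases p rule: ennreal_cases) (auto simp flip: ennreal_1)

lemma abs_le_lp_norm_on: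
  assumes "finite G" "p \<ge> 1" "j \<in> G"
  shows "\<bar>f j\<bar> \<le> lp_norm_on p G f"
  using \<open>p \<ge> 1\<close>
proof (cases rule: exponent_cases)
  case 1
  then show ?thesis using assms by (auto simp: lp_norm_on_top)
next
  case (2 a)
  have "\<bar>f j\<bar> = (\<bar>f j\<bar> powr a) powr (1 / a)"
    using 2 by (simp add: powr_powr)
  also have "\<dots> \<le> (\<Sum>j\<in>G. \<bar>f j\<bar> powr a) powr (1 / a)"
    using 2 assms by (intro powr_mono2 member_le_sum) auto
  finally show ?thesis using 2 by (simp add: lp_norm_on_real)
qed

lemma lp_norm_on_scale:
  assumes "finite G" "p \<ge> 1"
  shows "lp_norm_on p G (\<lambda>j. c * f j) = \<bar>c\<bar> * lp_norm_on p G f"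
  using \<open>p \<ge> 1\<close>
proof (cases rule: exponent_cases)
  case 1
  have "Max (insert 0 ((\<lambda>j. \<bar>c * f j\<bar>) ` G)) = Max ((\<lambda>x. \<bar>c\<bar> * x) ` insert 0 ((\<lambda>j. \<bar>f j\<bar>) ` G))"
    by (simp add: image_image abs_mult)
  also have "\<dots> = \<bar>c\<bar> * Max (insert 0 ((\<lambda>j. \<bar>f j\<bar>) ` G))"
    using assms by (intro mono_Max_commute[symmetric]) (auto intro!: monoI mult_left_mono)
  finally show ?thesis using 1 by (simp add: lp_norm_on_top)
next
  case (2 a)
  have "(\<Sum>j\<in>G. \<bar>c * f j\<bar> powr a) = \<bar>c\<bar> powr a * (\<Sum>j\<in>G. \<bar>f j\<bar> powr a)"
    by (simp add: abs_mult powr_mult sum_distrib_left)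
  then show ?thesis
    using 2 by (simp add: lp_norm_on_real powr_mult powr_powr)
qed

lemma lp_norm_on_eq_0:
  assumes "finite G" "p \<ge> 1" "\<And>j. j \<in> G \<Longrightarrow> f j = 0"
  shows "lp_norm_on p G f = 0"
proof -
  have "lp_norm_on p G f = lp_norm_on p G (\<lambda>j. 0 * f j)"
    using assms(3) by (intro lp_norm_on_cong) simp
  then show ?thesis using lp_norm_on_scale[OF assms(1,2), of 0 f] by simp
qed

section \<open>Hoelder's inequality and its sharpness\<close>

text \<open>
  On the unit balls no division by a norm is needed: for two finite exponents, Young's inequality bounds
  each product by \<open>\<bar>u j\<bar> powr a / a + \<bar>w j\<bar> powr b / b\<close>, and the sums of these bounds are at most
  \<open>1 / a + 1 / b = 1\<close>.
\<close>
lemma Hoelder_unit: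
  assumes "finite G" "p \<ge> 1" "1 / p + 1 / q = 1"
    and u: "lp_norm_on p G u \<le> 1" and w: "lp_norm_on q G w \<le> 1"
  shows "(\<Sum>j\<in>G. u j * w j) \<le> 1"
  using assms(2,3)
proof (cases rule: conjugate_exponents_cases)
  case 1
  have "(\<Sum>j\<in>G. u j * w j) \<le> (\<Sum>j\<in>G. \<bar>u j\<bar>)"
  proof (rule sum_mono)
    fix j assume "j \<in> G"
    then have "\<bar>w j\<bar> \<le> 1"
      using abs_le_lp_norm_on[of G q j w] w 1 assms(1) by simp
    then have "\<bar>u j\<bar> * \<bar>w j\<bar> \<le> \<bar>u j\<bar>"
      by (simp add: mult_left_le)
    then show "u j * w j \<le> \<bar>u j\<bar>" by (simp flip: abs_mult)
  qed
  then show ?thesis using u 1 by (simp add: lp_norm_on_1)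
next
  case 2
  have "(\<Sum>j\<in>G. u j * w j) \<le> (\<Sum>j\<in>G. \<bar>w j\<bar>)"
  proof (rule sum_mono)
    fix j assume "j \<in> G"
    then have "\<bar>u j\<bar> \<le> 1"
      using abs_le_lp_norm_on[of G p j u] u 2 assms(1) by simp
    then have "\<bar>u j\<bar> * \<bar>w j\<bar> \<le> \<bar>w j\<bar>"
      by (simp add: mult_left_le_one_le)
    then show "u j * w j \<le> \<bar>w j\<bar>" by (simp flip: abs_mult)
  qed
  then show ?thesis using w 2 by (simp add: lp_norm_on_1)
next
  case (3 a b)
  \<comment> \<open>A norm bounded by \<open>1\<close> has its \<open>c\<close>-th power, which is the sum, bounded by \<open>1\<close> as well.\<close>
  have le1: "(\<Sum>j\<in>G. \<bar>f j\<bar> powr c) \<le> 1"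
    if "lp_norm_on (ennreal c) G f \<le> 1" "c > 1" for f and c :: real
  proof -
    let ?S = "\<Sum>j\<in>G. \<bar>f j\<bar> powr c"
    have "?S = (?S powr (1 / c)) powr c"
      using that by (simp add: powr_powr sum_nonneg)
    also have "\<dots> \<le> 1 powr c"
      using that by (intro powr_mono2) (auto simp: lp_norm_on_real)
    finally show ?thesis by simp
  qed
  have "(\<Sum>j\<in>G. u j * w j) \<le> (\<Sum>j\<in>G. \<bar>u j\<bar> powr a / a + \<bar>w j\<bar> powr b / b)"
  proof (rule sum_mono)
    fix j
    have "u j * w j \<le> \<bar>u j\<bar> * \<bar>w j\<bar>" by (simp flip: abs_mult)
    also have "\<dots> \<le> \<bar>u j\<bar> powr a / a + \<bar>w j\<bar> powr b / b"
      using 3 by (intro Youngs_inequality) auto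
    finally show "u j * w j \<le> \<bar>u j\<bar> powr a / a + \<bar>w j\<bar> powr b / b" .
  qed
  also have "\<dots> = (\<Sum>j\<in>G. \<bar>u j\<bar> powr a) / a + (\<Sum>j\<in>G. \<bar>w j\<bar> powr b) / b"
    by (simp add: sum.distrib sum_divide_distrib)
  also have "\<dots> \<le> 1 / a + 1 / b"
    using 3 le1[of a u] le1[of b w] u w by (intro add_mono divide_right_mono) auto
  finally show ?thesis using 3 by simp
qed

text \<open>
  Homogeneity in \<open>u\<close> reduces this to the unit ball; when the norm vanishes there is nothing to
  normalise, but then \<open>u\<close> itself vanishes on \<open>G\<close>.
\<close>
lemma Hoelder_le_lp_norm_on:
  assumes "finite G" "p \<ge> 1" "1 / p + 1 / q = 1" and w: "lp_norm_on q G w \<le> 1"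
  shows "(\<Sum>j\<in>G. u j * w j) \<le> lp_norm_on p G u"
proof (cases "lp_norm_on p G u = 0")
  case True
  then have "u j = 0" if "j \<in> G" for j
    using abs_le_lp_norm_on[of G p j u] assms that by simp
  then show ?thesis using True by simp
next
  case False
  define N where "N = lp_norm_on p G u"
  have N: "N > 0"
    using False lp_norm_on_nonneg[OF assms(1), of p u] by (simp add: N_def)
  have "lp_norm_on p G (\<lambda>j. (1 / N) * u j) = 1"
    using lp_norm_on_scale[OF assms(1,2), of "1 / N" u] N by (simp flip: N_def)
  then have "(\<Sum>j\<in>G. (1 / N) * u j * w j) \<le> 1"
    using Hoelder_unit[OF assms(1-3) _ w, of "\<lambda>j. (1 / N) * u j"] by simp
  moreover have "(\<Sum>j\<in>G. (1 / N) * u j * w j) = (\<Sum>j\<in>G. u j * w j) / N"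
    by (simp add: sum_divide_distrib)
  ultimately show ?thesis using N by (simp add: N_def)
qed

text \<open>
  The maximiser takes the signs of \<open>w\<close>. Its mass sits on a largest coordinate of \<open>w\<close> if \<open>p = 1\<close>,
  it is flat if \<open>p = \<infinity>\<close>, and otherwise its moduli are proportional to \<open>\<bar>w j\<bar> powr (b - 1)\<close>,
  the equality case of Young's inequality.
\<close>
lemma Hoelder_attained:
  assumes "finite G" "p \<ge> 1" "1 / p + 1 / q = 1"
  obtains u where "lp_norm_on p G u \<le> 1" "(\<Sum>j\<in>G. u j * w j) = lp_norm_on q G w"
  using assms(2,3)
proof (cases rule: conjugate_exponents_cases)
  case 1
  show ?thesis
  proof (cases "G = {}")
    case True
    then show ?thesis using that[of "\<lambda>_. 0"] 1 by (simp add: lp_norm_on_1 lp_norm_on_top)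
  next
    case False
    then have "Max ((\<lambda>j. \<bar>w j\<bar>) ` G) \<in> (\<lambda>j. \<bar>w j\<bar>) ` G"
      using assms(1) by (intro Max_in) auto
    then obtain i where "i \<in> G" and Max_eq: "Max ((\<lambda>j. \<bar>w j\<bar>) ` G) = \<bar>w i\<bar>"
      by (rule imageE)
    moreover have "\<bar>w j\<bar> \<le> \<bar>w i\<bar>" if "j \<in> G" for j
      using that assms(1) unfolding Max_eq[symmetric] by (intro Max_ge) auto
    ultimately have i: "i \<in> G" "\<And>j. j \<in> G \<Longrightarrow> \<bar>w j\<bar> \<le> \<bar>w i\<bar>"
      by blast+
    have m: "lp_norm_on q G w = \<bar>w i\<bar>"
      using i assms(1) 1 by (auto simp: lp_norm_on_top intro!: Max_eqI)
    let ?u = "\<lambda>j. if j = i then sgn (w i) else 0"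
    have "(\<Sum>j\<in>G. \<bar>?u j\<bar>) = (\<Sum>j\<in>G. if j = i then \<bar>sgn (w i)\<bar> else 0)"
      by (rule sum.cong) auto
    then have n: "lp_norm_on p G ?u \<le> 1"
      using i 1 assms(1) by (simp add: lp_norm_on_1 abs_sgn_eq)
    have "(\<Sum>j\<in>G. ?u j * w j) = (\<Sum>j\<in>G. if j = i then sgn (w i) * w i else 0)"
      by (rule sum.cong) auto
    also have "\<dots> = \<bar>w i\<bar>"
      using i assms(1) by (simp add: abs_sgn mult.commute)
    finally show ?thesis using that n m by simp
  qed
next
  case 2
  have "lp_norm_on p G (\<lambda>j. sgn (w j)) \<le> 1"
    using assms(1) 2 by (auto simp: lp_norm_on_top abs_sgn_eq)
  moreover have "(\<Sum>j\<in>G. sgn (w j) * w j) = lp_norm_on q G w"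
    using 2 by (simp add: lp_norm_on_1 abs_sgn mult.commute)
  ultimately show ?thesis by (rule that)
next
  case (3 a b)
  define S where "S = (\<Sum>j\<in>G. \<bar>w j\<bar> powr b)"
  have S: "S \<ge> 0" by (simp add: S_def sum_nonneg)
  have ab: "(b - 1) * a = b" "1 - 1 / a = 1 / b"
    using 3 by (auto simp: field_simps)
  \<comment> \<open>If \<open>w\<close> vanishes on \<open>G\<close>, then \<open>S = 0\<close>, and \<open>0 powr _ = 0\<close> makes \<open>u\<close> zero, which attains the norm \<open>0\<close>.\<close>
  define u where "u j = sgn (w j) * \<bar>w j\<bar> powr (b - 1) * S powr (- (1 / a))" for j
  have "\<bar>u j\<bar> = \<bar>w j\<bar> powr (b - 1) * S powr (- (1 / a))" for j
    by (cases "w j = 0") (auto simp: u_def abs_mult abs_sgn_eq)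
  then have "\<bar>u j\<bar> powr a = \<bar>w j\<bar> powr b * S powr (-1)" for j
    using 3 ab by (simp add: powr_mult powr_powr)
  then have "(\<Sum>j\<in>G. \<bar>u j\<bar> powr a) = (\<Sum>j\<in>G. \<bar>w j\<bar> powr b * S powr (-1))"
    by (simp only:)
  also have "\<dots> = S * S powr (-1)"
    unfolding S_def by (rule sum_distrib_right[symmetric])
  also have "\<dots> \<le> 1"
    using S by (simp add: powr_minus_divide)
  finally have "lp_norm_on p G u \<le> 1"
    using 3 powr_mono2[of "1 / a" "\<Sum>j\<in>G. \<bar>u j\<bar> powr a" 1] by (simp add: lp_norm_on_real sum_nonneg)
  moreover have "(\<Sum>j\<in>G. u j * w j) = lp_norm_on q G w"
  proof -
    have "u j * w j = \<bar>w j\<bar> powr b * S powr (- (1 / a))" for j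
    proof (cases "w j = 0")
      case False
      then have "\<bar>w j\<bar> powr b = \<bar>w j\<bar> powr (b - 1) * \<bar>w j\<bar>"
        using powr_add[of "\<bar>w j\<bar>" "b - 1" 1] by simp
      then show ?thesis by (simp add: u_def abs_sgn)
    qed (simp add: u_def)
    then have "(\<Sum>j\<in>G. u j * w j) = (\<Sum>j\<in>G. \<bar>w j\<bar> powr b * S powr (- (1 / a)))"
      by (simp only:)
    also have "\<dots> = S * S powr (- (1 / a))"
      unfolding S_def by (rule sum_distrib_right[symmetric])
    also have "\<dots> = S powr (1 / b)"
      using S powr_add[of S 1 "- (1 / a)"] ab(2) by (cases "S = 0") auto
    finally show ?thesis using 3 by (simp add: S_def lp_norm_on_real)
  qed
  ultimately show ?thesis by (rule that)
qed

section \<open>Unit balls as intersections of half-spaces\<close>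

text \<open>
  All coordinates are kept and those outside \<open>G\<close> are free, so this is a cylinder over the
  unit ball of \<open>\<real>\<^bsup>G\<^esup>\<close>; in this form the dual set is a plain intersection.
\<close>
definition lp_unit_ball :: "ennreal \<Rightarrow> 'n::finite set \<Rightarrow> (real ^ 'n) set" where
  "lp_unit_ball p G = {x. lp_norm_on p G (\<lambda>j. x $ j) \<le> 1}"

text \<open>The unit ball of \<open>\<real>\<^bsup>G\<^esup>\<close> embedded in \<open>\<real>\<^bsup>d\<^esup>\<close> by extension by zero.\<close>
definition supported_ball :: "ennreal \<Rightarrow> 'n::finite set \<Rightarrow> (real ^ 'n) set" where
  "supported_ball p G = {x \<in> lp_unit_ball p G. \<forall>j. j \<notin> G \<longrightarrow> x $ j = 0}"

lemma inner_group_inj: "inner (group_inj G u) x = (\<Sum>j\<in>G. u j * x $ j)"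
proof -
  have "inner (group_inj G u) x = (\<Sum>j\<in>UNIV. if j \<in> G then u j * x $ j else 0)"
    unfolding inner_vec_def group_inj_def by (intro sum.cong) auto
  then show ?thesis by (simp add: sum.If_cases)
qed

text \<open>
  Hoelder's inequality gives one inclusion and its sharpness the other. Half-spaces being closed
  and convex, the topological and convexity properties of all the balls follow.
\<close>
lemma lp_unit_ball_polar:
  fixes G :: "'n::finite set"
  assumes "p \<ge> 1" "1 / p + 1 / q = 1"
  shows "lp_unit_ball q G = (\<Inter>u\<in>{u. lp_norm_on p G u \<le> 1}. {x. inner (group_inj G u) x \<le> 1})"
proof (intro set_eqI iffI)
  fix x :: "real ^ 'n" assume "x \<in> lp_unit_ball q G"
  then show "x \<in> (\<Inter>u\<in>{u. lp_norm_on p G u \<le> 1}. {x. inner (group_inj G u) x \<le> 1})"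
    using Hoelder_unit[OF _ assms, of G _ "\<lambda>j. x $ j"]
    by (auto simp: lp_unit_ball_def inner_group_inj)
next
  fix x :: "real ^ 'n"
  assume *: "x \<in> (\<Inter>u\<in>{u. lp_norm_on p G u \<le> 1}. {x. inner (group_inj G u) x \<le> 1})"
  obtain u where "lp_norm_on p G u \<le> 1" "(\<Sum>j\<in>G. u j * x $ j) = lp_norm_on q G (\<lambda>j. x $ j)"
    using Hoelder_attained[OF _ assms, of G "\<lambda>j. x $ j"] by auto
  then show "x \<in> lp_unit_ball q G"
    using * by (auto simp: lp_unit_ball_def inner_group_inj)
qed

lemma
  fixes G :: "'n::finite set"
  assumes "p \<ge> 1" "1 / p + 1 / q = 1"
  shows convex_lp_unit_ball: "convex (lp_unit_ball q G)"
    and closed_lp_unit_ball: "closed (lp_unit_ball q G)"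
  unfolding lp_unit_ball_polar[OF assms]
  by (auto intro!: convex_INT convex_halfspace_le closed_INT closed_halfspace_le)

lemma compact_if_coordinates_le_1:
  fixes S :: "(real ^ 'n) set"
  assumes "closed S" and "\<And>x j. x \<in> S \<Longrightarrow> \<bar>x $ j\<bar> \<le> 1"
  shows "compact S"
proof -
  have "norm x \<le> of_nat CARD('n)" if "x \<in> S" for x
  proof -
    have "norm x \<le> (\<Sum>j\<in>UNIV. \<bar>x $ j\<bar>)" by (rule norm_le_l1_cart)
    also have "\<dots> \<le> of_nat CARD('n) * 1"
      using assms(2)[OF that] by (intro sum_bounded_above) auto
    finally show ?thesis by simp
  qed
  then show ?thesis
    using assms(1) by (auto simp: compact_eq_bounded_closed bounded_iff)
qed

lemma
  fixes G :: "'n::finite set"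
  assumes "p \<ge> 1" "1 / p + 1 / q = 1"
  shows convex_supported_ball: "convex (supported_ball p G)"
    and compact_supported_ball: "compact (supported_ball p G)"
    and zero_in_supported_ball: "0 \<in> supported_ball p G"
proof -
  note sym = conjugate_exponents_sym[OF assms]
  \<comment> \<open>The polar description of a ball refers to the conjugate exponent, so for the \<open>\<ell>\<^sub>p\<close> ball the
      exponents are used with their roles exchanged.\<close>
  have eq: "supported_ball p G = lp_unit_ball p G \<inter> (\<Inter>j\<in>- G. {x. inner (axis j 1) x = 0})"
    by (auto simp: supported_ball_def inner_axis')
  show "convex (supported_ball p G)"
    unfolding eq
    by (intro convex_Int convex_INT convex_hyperplane convex_lp_unit_ball[OF sym])
  show "compact (supported_ball p G)"
  proof (rule compact_if_coordinates_le_1)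
    show "closed (supported_ball p G)"
      unfolding eq
      by (intro closed_Int closed_INT ballI closed_hyperplane closed_lp_unit_ball[OF sym])
    show "\<bar>x $ j\<bar> \<le> 1" if "x \<in> supported_ball p G" for x j
      using that abs_le_lp_norm_on[of G p j "\<lambda>j. x $ j"] assms(1)
      by (cases "j \<in> G") (auto simp: supported_ball_def lp_unit_ball_def)
  qed
  show "0 \<in> supported_ball p G"
    using assms(1) by (simp add: supported_ball_def lp_unit_ball_def lp_norm_on_eq_0)
qed

section \<open>The penalty as a support function\<close>

lemma dual_unit_set_eq: "dual_unit_set q G B = (\<Inter>r\<in>{1..B}. lp_unit_ball q (G r))"
  by (auto simp: dual_unit_set_def lp_unit_ball_def)

lemma
  fixes G :: "nat \<Rightarrow> 'n::finite set"
  assumes "p \<ge> 1" "1 / p + 1 / q = 1"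
  shows convex_dual_unit_set: "convex (dual_unit_set q G B)"
    and closed_dual_unit_set: "closed (dual_unit_set q G B)"
    and zero_in_dual_unit_set: "0 \<in> dual_unit_set q G B"
proof -
  show "convex (dual_unit_set q G B)" "closed (dual_unit_set q G B)"
    unfolding dual_unit_set_eq
    by (auto intro!: convex_INT closed_INT convex_lp_unit_ball closed_lp_unit_ball assms)
  show "0 \<in> dual_unit_set q G B"
    using conjugate_exponents_sym(1)[OF assms] by (simp add: dual_unit_set_def lp_norm_on_eq_0)
qed

text \<open>
  Boundedness is where the covering of all coordinates by the groups enters: each coordinate is
  controlled by the norm on some group.
\<close>
lemma compact_dual_unit_set:
  fixes G :: "nat \<Rightarrow> 'n::finite set"
  assumes "(\<Union>r\<in>{1..B}. G r) = UNIV" "p \<ge> 1" "1 / p + 1 / q = 1"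
  shows "compact (dual_unit_set q G B)"
proof (rule compact_if_coordinates_le_1)
  show "closed (dual_unit_set q G B)"
    using assms(2,3) by (rule closed_dual_unit_set)
  fix x j assume x: "x \<in> dual_unit_set q G B"
  obtain r where r: "r \<in> {1..B}" "j \<in> G r" using assms(1) by blast
  have "\<bar>x $ j\<bar> \<le> lp_norm_on q (G r) (\<lambda>j. x $ j)"
    using abs_le_lp_norm_on[of "G r" q j "\<lambda>j. x $ j"] r
      conjugate_exponents_sym(1)[OF assms(2,3)] by simp
  then show "\<bar>x $ j\<bar> \<le> 1"
    using x r by (force simp: dual_unit_set_def)
qed

text \<open>Weak duality: Hoelder's inequality, group by group.\<close>
lemma inner_le_group_cost:
  assumes "p \<ge> 1" "1 / p + 1 / q = 1"
    and k: "k \<in> dual_unit_set q G B" and v: "v \<in> decompositions G B x"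
  shows "inner k x \<le> group_cost p G B v"
proof -
  have "inner k x = (\<Sum>r = 1..B. inner (group_inj (G r) (v r)) k)"
    using v by (auto simp: decompositions_def group_sum_def inner_sum_right inner_commute)
  also have "\<dots> \<le> group_cost p G B v"
    unfolding group_cost_def inner_group_inj
    using k by (intro sum_mono Hoelder_le_lp_norm_on[OF _ assms(1,2)]) (auto simp: dual_unit_set_def)
  finally show ?thesis .
qed

text \<open>
  The balls are convex, so a point of the hull of their union needs only one point from each ball;
  the weighted points are the summands of the decomposition, and the weights bound their norms.
\<close>
lemma scaled_atom_hull_decomposition:
  fixes G :: "nat \<Rightarrow> 'n::finite set"
  assumes "p \<ge> 1" "1 / p + 1 / q = 1"
    and "s \<ge> 0" and h: "h \<in> convex hull (\<Union>r\<in>{1..B}. supported_ball p (G r))"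
  obtains v where "v \<in> decompositions G B (s *\<^sub>R h)" "group_cost p G B v \<le> s"
proof -
  have "\<forall>r\<in>{1..B}. convex (supported_ball p (G r)) \<and> supported_ball p (G r) \<noteq> {}"
    using convex_supported_ball[OF assms(1,2)] zero_in_supported_ball[OF assms(1,2)] by blast
  from convex_hull_finite_union[OF finite_atLeastAtMost this] h
  obtain c e where c': "\<forall>r\<in>{1..B}. c r \<ge> 0" "sum c {1..B} = 1"
    and e': "\<forall>r\<in>{1..B}. e r \<in> supported_ball p (G r)"
    and h: "h = (\<Sum>r = 1..B. c r *\<^sub>R e r)"
    by blast
  note c = bspec[OF c'(1)] c'(2) and e = bspec[OF e']
  define v where "v = (\<lambda>r\<in>{1..B}. \<lambda>j\<in>G r. (s * c r) * e r $ j)"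
  have "group_inj (G r) (v r) = s *\<^sub>R c r *\<^sub>R e r" if "r \<in> {1..B}" for r
    using that e[OF that] by (auto simp: v_def group_inj_def vec_eq_iff supported_ball_def)
  then have "group_sum G B v = s *\<^sub>R h"
    by (simp add: group_sum_def h scaleR_sum_right)
  then have "v \<in> decompositions G B (s *\<^sub>R h)"
    by (auto simp: decompositions_def v_def)
  moreover have "group_cost p G B v \<le> s"
  proof -
    have "lp_norm_on p (G r) (v r) \<le> s * c r" if r: "r \<in> {1..B}" for r
    proof -
      have "lp_norm_on p (G r) (v r) = lp_norm_on p (G r) (\<lambda>j. (s * c r) * e r $ j)"
        using r by (intro lp_norm_on_cong) (simp add: v_def)
      also have "\<dots> = (s * c r) * lp_norm_on p (G r) (\<lambda>j. e r $ j)"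
        using assms(1,3) c(1)[OF r] by (subst lp_norm_on_scale) auto
      also have "\<dots> \<le> (s * c r) * 1"
        using assms(3) c(1)[OF r] e[OF r]
        by (intro mult_left_mono) (auto simp: supported_ball_def lp_unit_ball_def)
      finally show ?thesis by simp
    qed
    then have "group_cost p G B v \<le> (\<Sum>r = 1..B. s * c r)"
      unfolding group_cost_def by (intro sum_mono) auto
    also have "\<dots> = s" using c(2) by (simp flip: sum_distrib_left)
    finally show ?thesis .
  qed
  ultimately show ?thesis by (rule that)
qed

text \<open>
  Strong duality with attainment: for a maximiser \<open>k\<close> over the dual set, the point \<open>x\<close> lies in the
  hull of the balls scaled by \<open>s = k \<bullet> x\<close>, since otherwise a separating functional yields a dual
  point that beats \<open>k\<close>. This covers \<open>s = 0\<close>, where the scaled hull is \<open>{0}\<close>.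
\<close>
lemma decomposition_attaining_support:
  fixes G :: "nat \<Rightarrow> 'n::finite set"
  assumes "B \<ge> 1" "p \<ge> 1" "1 / p + 1 / q = 1"
    and k: "k \<in> dual_unit_set q G B"
    and max: "\<And>k'. k' \<in> dual_unit_set q G B \<Longrightarrow> inner k' x \<le> inner k x"
  obtains v where "v \<in> decompositions G B x" "group_cost p G B v \<le> inner k x"
proof -
  define s where "s = inner k x"
  let ?A = "\<Union>r\<in>{1..B}. supported_ball p (G r)"
  have s: "s \<ge> 0"
    using max[OF zero_in_dual_unit_set[OF assms(2,3)]] by (simp add: s_def)
  have "x \<in> (*\<^sub>R) s ` (convex hull ?A)"
  proof (rule ccontr)
    assume nin: "x \<notin> (*\<^sub>R) s ` (convex hull ?A)"
    have "compact ?A"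
      by (intro compact_UN) (auto intro: compact_supported_ball[OF assms(2,3)])
    then have "closed ((*\<^sub>R) s ` (convex hull ?A))"
      by (intro compact_imp_closed compact_scaling compact_convex_hull)
    moreover have "convex ((*\<^sub>R) s ` (convex hull ?A))"
      by (intro convex_scaling convex_convex_hull)
    ultimately obtain a' b' where sep': "inner a' x < b'"
        "\<And>y. y \<in> (*\<^sub>R) s ` (convex hull ?A) \<Longrightarrow> inner a' y > b'"
      using separating_hyperplane_closed_point nin by metis
    \<comment> \<open>Orient the hyperplane so that \<open>x\<close> is on its upper side.\<close>
    define a b where "a = - a'" and "b = - b'"
    have sep: "inner a x > b" "\<And>y. y \<in> ?A \<Longrightarrow> s * inner a y < b"
      using sep'(1) sep'(2)[OF imageI[OF hull_inc]] by (fastforce simp: a_def b_def)+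
    \<comment> \<open>\<open>m\<close> is the gauge of the dual set at \<open>a\<close>. Sharpness of Hoelder's inequality on
        a group that attains it turns the separation into \<open>s * m < b\<close>.\<close>
    define m where "m = Max ((\<lambda>r. lp_norm_on q (G r) (\<lambda>j. a $ j)) ` {1..B})"
    have m_ge: "lp_norm_on q (G r) (\<lambda>j. a $ j) \<le> m" if "r \<in> {1..B}" for r
      using that unfolding m_def by (intro Max_ge) auto
    have "m \<in> (\<lambda>r. lp_norm_on q (G r) (\<lambda>j. a $ j)) ` {1..B}"
      using assms(1) unfolding m_def by (intro Max_in) auto
    then obtain r where r: "r \<in> {1..B}" "m = lp_norm_on q (G r) (\<lambda>j. a $ j)"
      by auto
    have m0: "m \<ge> 0" using r(2) by (simp add: lp_norm_on_nonneg)
    obtain u where u: "lp_norm_on p (G r) u \<le> 1" "(\<Sum>j\<in>G r. u j * a $ j) = m"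
      using Hoelder_attained[OF _ assms(2,3), of "G r" "\<lambda>j. a $ j"] r by auto
    have "lp_norm_on p (G r) (\<lambda>j. group_inj (G r) u $ j) = lp_norm_on p (G r) u"
      by (rule lp_norm_on_cong) (simp add: group_inj_def)
    then have "group_inj (G r) u \<in> supported_ball p (G r)"
      using u(1) by (simp add: supported_ball_def lp_unit_ball_def) (simp add: group_inj_def)
    moreover have "inner a (group_inj (G r) u) = m"
      using u(2) by (simp add: inner_group_inj inner_commute[of a])
    ultimately have sm: "s * m < b"
      using sep(2)[of "group_inj (G r) u"] r(1) by (metis UN_I)
    \<comment> \<open>Dividing by a number strictly above \<open>m\<close> also works when \<open>m = 0\<close>.\<close>
    have "\<exists>m'>m. s * m' < b"
    proof (cases "s = 0")
      case False
      then have "m < b / s" using s sm by (simp add: field_simps)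
      then obtain m' where "m < m'" "m' < b / s" using dense by blast
      then show ?thesis using s False by (auto simp: field_simps)
    qed (use sm in \<open>auto intro: gt_ex\<close>)
    then obtain m' where m': "m' > m" "s * m' < b" by blast
    have "(1 / m') *\<^sub>R a \<in> dual_unit_set q G B"
      unfolding dual_unit_set_def
    proof (intro CollectI ballI)
      fix r assume r: "r \<in> {1..B}"
      have "lp_norm_on q (G r) (\<lambda>j. ((1 / m') *\<^sub>R a) $ j)
          = (1 / m') * lp_norm_on q (G r) (\<lambda>j. a $ j)"
        using lp_norm_on_scale[of "G r" q "1 / m'" "\<lambda>j. a $ j"] m' m0
          conjugate_exponents_sym(1)[OF assms(2,3)] by simp
      also have "\<dots> \<le> 1"
        using m_ge[OF r] m' m0 by (simp add: field_simps)
      finally show "lp_norm_on q (G r) (\<lambda>j. ((1 / m') *\<^sub>R a) $ j) \<le> 1" .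
    qed
    from max[OF this] have "inner a x \<le> s * m'"
      using m' m0 by (simp add: s_def field_simps)
    then show False using sep(1) m'(2) by linarith
  qed
  then obtain h where h: "h \<in> convex hull ?A" "x = s *\<^sub>R h" by auto
  show ?thesis
    using scaled_atom_hull_decomposition[OF assms(2,3) s h(1)] that h(2) s_def by metis
qed

lemma group_penalty_eq_cost:
  assumes "is_arg_min (group_cost p G B) (\<lambda>v. v \<in> decompositions G B x) v"
  shows "group_penalty p G B x = group_cost p G B v"
  unfolding group_penalty_def
  by (rule Least_equality) (use assms in \<open>auto simp: is_arg_min_linorder\<close>)

section \<open>Proximity operators of support functions\<close>

text \<open>
  Moreau's decomposition. The hypotheses on \<open>f\<close> express that it agrees with the support
  function of \<open>K\<close> wherever the latter is attained. With \<open>l *\<^sub>R k\<close> the projection of \<open>z\<close>, the variational inequality makes \<open>k\<close> a maximiser at the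
  residual \<open>P z\<close>, so replacing \<open>f\<close> by the linear minorant \<open>inner k\<close> keeps the value at
  \<open>P z\<close>. The objective thereby becomes a quadratic with vertex \<open>P z\<close>, which yields the
  minimality of \<open>P z\<close> and its uniqueness together.
\<close>
lemma prox_objective_quadratic_growth:
  fixes f :: "'a::euclidean_space \<Rightarrow> real"
  assumes "convex K" "closed K" "K \<noteq> {}" "l > 0"
    and ge: "\<And>k x. k \<in> K \<Longrightarrow> inner k x \<le> f x"
    and le: "\<And>k x. k \<in> K \<Longrightarrow> (\<And>k'. k' \<in> K \<Longrightarrow> inner k' x \<le> inner k x) \<Longrightarrow> f x \<le> inner k x"
  defines "\<And>z. P z \<equiv> z - closest_point ((*\<^sub>R) l ` K) z"
  shows "prox_objective l f z (P z) + (norm (x - P z))\<^sup>2 / (2 * l) \<le> prox_objective l f z x"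
proof -
  let ?L = "(*\<^sub>R) l ` K" and ?x = "P z"
  have L: "convex ?L" "closed ?L" "?L \<noteq> {}"
    using assms by (auto intro: convex_scaling closed_scaling)
  obtain k where k: "k \<in> K" "closest_point ?L z = l *\<^sub>R k"
    using closest_point_in_set[OF L(2,3), of z] by auto
  have x: "?x = z - l *\<^sub>R k" by (simp add: P_def k)
  have "inner k' ?x \<le> inner k ?x" if "k' \<in> K" for k'
  proof -
    have "inner ?x (l *\<^sub>R k' - l *\<^sub>R k) \<le> 0"
      using closest_point_dot[OF L(1,2), of "l *\<^sub>R k'" z] that k x by auto
    then have "l * (inner ?x k' - inner ?x k) \<le> 0"
      by (simp add: inner_diff_right right_diff_distrib)
    then show ?thesis
      using \<open>l > 0\<close> by (simp add: mult_le_0_iff inner_commute)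
  qed
  then have fx: "f ?x \<le> inner k ?x" by (rule le[OF k(1)])
  have "prox_objective l f z ?x + (norm (x - ?x))\<^sup>2 / (2 * l)
      \<le> ((norm (?x - z))\<^sup>2 + (norm (x - ?x))\<^sup>2) / (2 * l) + inner k ?x"
    using fx by (simp add: prox_objective_def add_divide_distrib)
  also have "\<dots> = (norm (x - z))\<^sup>2 / (2 * l) + inner k x"
  proof -
    \<comment> \<open>Completing the square, with \<open>z = y + l *\<^sub>R k\<close> substituted so that it is a polynomial identity.\<close>
    have "(norm (y - (y + l *\<^sub>R k)))\<^sup>2 + (norm (x - y))\<^sup>2 + 2 * l * inner k y
        = (norm (x - (y + l *\<^sub>R k)))\<^sup>2 + 2 * l * inner k x" for y
      by (simp add: power2_norm_eq_inner inner_diff_left inner_diff_right inner_add_left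
          inner_add_right inner_commute algebra_simps power2_eq_square[of l])
    from this[of ?x]
    have "(norm (?x - z))\<^sup>2 + (norm (x - ?x))\<^sup>2 + 2 * l * inner k ?x
        = (norm (x - z))\<^sup>2 + 2 * l * inner k x"
      by (simp add: x)
    then show ?thesis
      using \<open>l > 0\<close> by (simp add: field_simps)
  qed
  also have "\<dots> \<le> prox_objective l f z x"
    using ge[OF k(1)] by (simp add: prox_objective_def)
  finally show ?thesis .
qed

lemma is_arg_min_quadratic_growth_iff:
  fixes F :: "'a::real_normed_vector \<Rightarrow> real"
  assumes "l > 0" "\<And>x. F y + (norm (x - y))\<^sup>2 / (2 * l) \<le> F x"
  shows "is_arg_min F (\<lambda>_. True) x \<longleftrightarrow> x = y"
proof
  assume "is_arg_min F (\<lambda>_. True) x"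
  then have "F x \<le> F y" by (simp add: is_arg_min_linorder)
  then have "(norm (x - y))\<^sup>2 / (2 * l) \<le> 0" using assms(2)[of x] by linarith
  then show "x = y" using assms(1) by (simp add: divide_le_0_iff)
next
  have "F y \<le> F x" for x
    using assms(2)[of x] assms(1) by (smt (verit) divide_nonneg_nonneg zero_le_power2)
  then show "x = y \<Longrightarrow> is_arg_min F (\<lambda>_. True) x" by (simp add: is_arg_min_linorder)
qed

section \<open>The proximity operator of the group penalty\<close>

theorem lemma1:
  fixes G :: "nat \<Rightarrow> 'n::finite set" and B :: nat and p q :: ennreal and l :: real
  assumes "B \<ge> 1"
    and "(\<Union>r\<in>{1..B}. G r) = UNIV"
    and "p \<ge> 1"
    and "1 / p + 1 / q = 1"
    and "l > 0"
  shows "(\<forall>x. \<exists>v. is_arg_min (group_cost p G B) (\<lambda>v. v \<in> decompositions G B x) v) \<and>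
    (\<forall>z. \<exists>!x. is_arg_min (prox_objective l (group_penalty p G B) z) (\<lambda>_. True) x) \<and>
    prox l (group_penalty p G B) =
      (\<lambda>z. z - closest_point ((\<lambda>x. l *\<^sub>R x) ` dual_unit_set q G B) z)"
proof -
  let ?K = "dual_unit_set q G B"
  have arg_min: "\<exists>v. is_arg_min (group_cost p G B) (\<lambda>v. v \<in> decompositions G B x) v" for x
  proof -
    have "\<exists>k\<in>?K. \<forall>k'\<in>?K. inner k' x \<le> inner k x"
      using compact_dual_unit_set[OF assms(2-4)] zero_in_dual_unit_set[OF assms(3,4)]
      by (intro continuous_attains_sup continuous_intros) auto
    then obtain k where k: "k \<in> ?K" "\<And>k'. k' \<in> ?K \<Longrightarrow> inner k' x \<le> inner k x"
      by blast
    obtain v where "v \<in> decompositions G B x" "group_cost p G B v \<le> inner k x"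
      using decomposition_attaining_support[OF assms(1,3,4) k] by blast
    then have "is_arg_min (group_cost p G B) (\<lambda>v. v \<in> decompositions G B x) v"
      using inner_le_group_cost[OF assms(3,4) k(1)]
      by (auto simp: is_arg_min_linorder intro: order_trans)
    then show ?thesis by blast
  qed
  have ge: "inner k x \<le> group_penalty p G B x" if "k \<in> ?K" for k x
    using arg_min[of x] group_penalty_eq_cost inner_le_group_cost[OF assms(3,4) that]
    by (metis is_arg_min_def)
  have le: "group_penalty p G B x \<le> inner k x"
    if k: "k \<in> ?K" "\<And>k'. k' \<in> ?K \<Longrightarrow> inner k' x \<le> inner k x" for k x
  proof -
    obtain v where v: "v \<in> decompositions G B x" "group_cost p G B v \<le> inner k x"
      using decomposition_attaining_support[OF assms(1,3,4) k] by blast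
    obtain w where w: "is_arg_min (group_cost p G B) (\<lambda>v. v \<in> decompositions G B x) w"
      using arg_min by blast
    then have "group_cost p G B w \<le> group_cost p G B v"
      using v(1) by (simp add: is_arg_min_linorder)
    then show ?thesis using v(2) group_penalty_eq_cost[OF w] by linarith
  qed
  have K: "convex ?K" "closed ?K" "?K \<noteq> {}"
    using convex_dual_unit_set closed_dual_unit_set zero_in_dual_unit_set assms(3,4) by blast+
  have iff: "is_arg_min (prox_objective l (group_penalty p G B) z) (\<lambda>_. True) x
      \<longleftrightarrow> x = z - closest_point ((\<lambda>x. l *\<^sub>R x) ` ?K) z" for x z
    by (rule is_arg_min_quadratic_growth_iff[OF assms(5)],
        rule prox_objective_quadratic_growth[OF K assms(5)], erule ge, erule le, assumption)
  show ?thesis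
    using arg_min by (auto simp: prox_def iff)
qed

end
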